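(* Let $(P,\mu,\eta,c)$ be an H-group with base point $p_0$ and let $P'$ be a normal sub-H-group of $P$. Then $P/P'=\{gP' \mid g\in P\}$ is a group, with multiplication $(g_1P').(g_2P')=(g_1.g_2)P'$ and inversion $(gP')^{-1}=g^{-1}P'$, in which the coset $p_0P'$ (which equals $\widetilde{P'}$) is the identity element.
   Context: An H-group $(P,\mu,\eta,c)$ is a pointed space $(P,p_0)$ with continuous pointed maps $\mu:P\times P\to P$, $\eta:P\to P$ and the constant map $c:P\to P$ at $p_0$ such that, via pointed homotopies, $\mu(1_P,c)\simeq\mu(c,1_P)\simeq 1_P$, $\mu(\eta,1_P)\simeq\mu(1_P,\eta)\simeq c$ and $\mu(\mu\times 1_P)\simeq\mu(1_P\times\mu)$. Write $g.h=\mu(g,h)$ and $g^{-1}=\eta(g)$. An H-homomorphism between H-groups $(P,\mu,\eta,c)$ and $(Q,\mu_2,\eta_2,c_2)$ is a continuous map $\varphi:P\to Q$ with $\varphi\mu\simeq\mu_2(\varphi\times\varphi)$ and $\varphi\eta\simeq\eta_2\varphi$. A sub-H-group of $P$ is a pointed subspace $P'\ni p_0$ which is itself an H-group (with base point $p_0$) such that the inclusion $P'\to P$ is an H-homomorphism. For $A\subseteq P$ and $g\in P$, write $g\,\widetilde{\in}\,A$ if there is a path in $P$ from $g$ to a point of $A$; put $\widetilde{A}=\{g\in P\mid g\,\widetilde{\in}\,A\}$. The left coset of a sub-H-group $P'$ is $gP'=\{g'\in P\mid g^{-1}.g'\,\widetilde{\in}\,P'\}$. A sub-H-group $P'$ is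 normal if $g.g'.g^{-1}\,\widetilde{\in}\,P'$ for all $g\in P$, $g'\in P'$ (the bracketing is irrelevant, since both bracketings lie in the same path component of $P$). *)

theory Defs
  imports "HOL-Analysis.Analysis" "HOL-Algebra.Group"
begin

definition pointed_homotopic ::
    "'a topology \<Rightarrow> 'a \<Rightarrow> 'b topology \<Rightarrow> 'b \<Rightarrow> ('a \<Rightarrow> 'b) \<Rightarrow> ('a \<Rightarrow> 'b) \<Rightarrow> bool"
  where "pointed_homotopic X x0 Y y0 f g \<longleftrightarrow> homotopic_with (\<lambda>h. h x0 = y0) X Y f g"

definition freely_homotopic ::
    "'a topology \<Rightarrow> 'b topology \<Rightarrow> ('a \<Rightarrow> 'b) \<Rightarrow> ('a \<Rightarrow> 'b) \<Rightarrow> bool"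
  where "freely_homotopic X Y f g \<longleftrightarrow> homotopic_with (\<lambda>_. True) X Y f g"

text \<open>The data \<open>(P, \<mu>, \<eta>, c)\<close> with base point \<open>p\<^sub>0\<close>. The map \<open>c\<close> is not a separate field,
  since it is determined as the constant map at \<open>p\<^sub>0\<close>. The operations are relevant only on
  the points of the space.\<close>

record 'a hgroup =
  hspace :: "'a topology"
  hbase  :: 'a
  hmu    :: "'a \<times> 'a \<Rightarrow> 'a"
  heta   :: "'a \<Rightarrow> 'a"

abbreviation hpoints :: "'a hgroup \<Rightarrow> 'a set"
  where "hpoints P \<equiv> topspace (hspace P)"

definition hconst :: "'a hgroup \<Rightarrow> 'a \<Rightarrow> 'a"
  where "hconst P = (\<lambda>_. hbase P)"

definition H_group :: "'a hgroup \<Rightarrow> bool"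
  where "H_group P \<longleftrightarrow>
    (let X = hspace P; p0 = hbase P; \<mu> = hmu P; \<eta> = heta P; c = hconst P in
      p0 \<in> topspace X \<and>
      continuous_map (prod_topology X X) X \<mu> \<and> \<mu> (p0, p0) = p0 \<and>
      continuous_map X X \<eta> \<and> \<eta> p0 = p0 \<and>
      pointed_homotopic X p0 X p0 (\<lambda>x. \<mu> (x, c x)) (\<lambda>x. x) \<and>
      pointed_homotopic X p0 X p0 (\<lambda>x. \<mu> (c x, x)) (\<lambda>x. x) \<and>
      pointed_homotopic X p0 X p0 (\<lambda>x. \<mu> (\<eta> x, x)) c \<and>
      pointed_homotopic X p0 X p0 (\<lambda>x. \<mu> (x, \<eta> x)) c \<and>
      pointed_homotopic (prod_topology (prod_topology X X) X) ((p0, p0), p0) X p0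
        (\<lambda>((x, y), z). \<mu> (\<mu> (x, y), z)) (\<lambda>((x, y), z). \<mu> (x, \<mu> (y, z))))"

text \<open>An H-homomorphism is only required to be continuous, not pointed, so the homotopies
  here are free.\<close>

definition H_homomorphism :: "'a hgroup \<Rightarrow> 'b hgroup \<Rightarrow> ('a \<Rightarrow> 'b) \<Rightarrow> bool"
  where "H_homomorphism P Q \<phi> \<longleftrightarrow>
    continuous_map (hspace P) (hspace Q) \<phi> \<and>
    freely_homotopic (prod_topology (hspace P) (hspace P)) (hspace Q)
      (\<lambda>(x, y). \<phi> (hmu P (x, y))) (\<lambda>(x, y). hmu Q (\<phi> x, \<phi> y)) \<and>
    freely_homotopic (hspace P) (hspace Q) (\<lambda>x. \<phi> (heta P x)) (\<lambda>x. heta Q (\<phi> x))"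

text \<open>The operations of a sub-H-group need not be restrictions of those of \<open>P\<close>; they agree
  with them only up to homotopy in \<open>P\<close>.\<close>

definition sub_H_group :: "'a hgroup \<Rightarrow> 'a set \<Rightarrow> bool"
  where "sub_H_group P S \<longleftrightarrow>
    S \<subseteq> hpoints P \<and> hbase P \<in> S \<and>
    (\<exists>Q. hspace Q = subtopology (hspace P) S \<and> hbase Q = hbase P \<and>
         H_group Q \<and> H_homomorphism Q P (\<lambda>x. x))"

definition path_in :: "'a hgroup \<Rightarrow> 'a \<Rightarrow> 'a set \<Rightarrow> bool"
  where "path_in P g A \<longleftrightarrow> (\<exists>a\<in>A. path_component_of (hspace P) g a)"

definition path_saturation :: "'a hgroup \<Rightarrow> 'a set \<Rightarrow> 'a set"
  where "path_saturation P A = {g \<in> hpoints P. path_in P g A}"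

definition left_coset :: "'a hgroup \<Rightarrow> 'a set \<Rightarrow> 'a \<Rightarrow> 'a set"
  where "left_coset P S g = {g' \<in> hpoints P. path_in P (hmu P (heta P g, g')) S}"

definition normal_sub_H_group :: "'a hgroup \<Rightarrow> 'a set \<Rightarrow> bool"
  where "normal_sub_H_group P S \<longleftrightarrow>
    sub_H_group P S \<and>
    (\<forall>g\<in>hpoints P. \<forall>g'\<in>S. path_in P (hmu P (hmu P (g, g'), heta P g)) S)"

text \<open>The product of two cosets is the coset of the product of any representatives; that it
  does not depend on them is part of what has to be shown, and \<open>THE\<close> denotes the intended
  coset only once this is known.\<close>

definition H_quotient :: "'a hgroup \<Rightarrow> 'a set \<Rightarrow> 'a set monoid"
  where "H_quotient P S =
    \<lparr> carrier = {left_coset P S g | g. g \<in> hpoints P},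
      mult = (\<lambda>A B. THE C. \<exists>g1\<in>hpoints P. \<exists>g2\<in>hpoints P.
        A = left_coset P S g1 \<and> B = left_coset P S g2 \<and> C = left_coset P S (hmu P (g1, g2))),
      one = left_coset P S (hbase P) \<rparr>"

end

(* The multiplication of an H-group P makes the set of its path components a group pi_0(P), since
   pointwise a homotopy is a path. The path components meeting a normal sub-H-group P' form a
   normal subgroup N of pi_0(P); here the operations of P' may be replaced by those of P because
   they agree up to paths in P. Membership in g P' depends only on the path component, and in
   pi_0(P) the coset g P' is the coset [g] N. Hence P/P' is isomorphic to pi_0(P)/N. *)
theory Submission
  imports Defs "HOL-Algebra.Coset"
begin

section \<open>Homotopies evaluated at a point\<close>

text \<open>The track of \<open>x\<close> under the homotopy is a path from \<open>f x\<close> to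
  \<open>g x\<close>. Since \<open>Q\<close> is arbitrary, this serves the pointed homotopies of an
  H-group and the free homotopies of an H-homomorphism alike.\<close>

lemma homotopic_with_imp_path_component_of:
  assumes "homotopic_with Q X Y f g" and "x \<in> topspace X"
  shows "path_component_of Y (f x) (g x)"
proof -
  obtain h where h: "continuous_map (prod_topology (top_of_set {0..1::real}) X) Y h"
    "\<And>x. h (0, x) = f x" "\<And>x. h (1, x) = g x"
    using assms(1) unfolding homotopic_with_def by blast
  have "continuous_map (top_of_set {0..1::real}) (prod_topology (top_of_set {0..1}) X) (\<lambda>t. (t, x))"
    using assms(2) by (intro continuous_map_pairedI) auto
  then have "pathin Y (h \<circ> (\<lambda>t. (t, x)))"
    unfolding pathin_def using h(1) by (rule continuous_map_compose)
  then show ?thesis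
    unfolding path_component_of_def using h(2,3) by (intro exI[of _ "h \<circ> (\<lambda>t. (t, x))"]) simp
qed

section \<open>The group of path components\<close>

definition pi0_class :: "'a hgroup \<Rightarrow> 'a \<Rightarrow> 'a set"
  where "pi0_class P x = path_component_of_set (hspace P) x"

text \<open>Taking the union over all representatives avoids choosing any; for an H-group all the
  sets in this union coincide.\<close>

definition pi0 :: "'a hgroup \<Rightarrow> 'a set monoid"
  where "pi0 P =
    \<lparr> carrier = path_components_of (hspace P),
      mult = (\<lambda>A B. \<Union>a\<in>A. \<Union>b\<in>B. pi0_class P (hmu P (a, b))),
      one = pi0_class P (hbase P) \<rparr>"

lemma pi0_class_eqI: "path_component_of (hspace P) x y \<Longrightarrow> pi0_class P x = pi0_class P y"
  by (simp add: pi0_class_def path_component_of_equiv)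

text \<open>Points outside the space all have the empty class, so \<open>x\<close> has to lie in the
  space.\<close>

lemma pi0_class_eq_iff:
  assumes "x \<in> hpoints P"
  shows "pi0_class P x = pi0_class P y \<longleftrightarrow> path_component_of (hspace P) x y"
  using assms path_component_of_refl[of "hspace P"]
  by (metis mem_Collect_eq path_component_of_sym pi0_class_def pi0_class_eqI)

lemma carrier_pi0: "carrier (pi0 P) = pi0_class P ` hpoints P"
  by (auto simp: pi0_def pi0_class_def path_components_of_def)

lemma one_pi0: "\<one>\<^bsub>pi0 P\<^esub> = pi0_class P (hbase P)"
  by (simp add: pi0_def)

lemma path_in_iff:
  assumes "S \<subseteq> hpoints P" and "x \<in> hpoints P"
  shows "path_in P x S \<longleftrightarrow> pi0_class P x \<in> pi0_class P ` S"
  using assms by (auto simp: path_in_def pi0_class_eq_iff)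

context
  fixes P :: "'a hgroup"
  assumes H_group_P: "H_group P"
begin

lemma hbase_closed: "hbase P \<in> hpoints P"
  using H_group_P by (simp add: H_group_def Let_def)

lemma continuous_map_hmu: "continuous_map (prod_topology (hspace P) (hspace P)) (hspace P) (hmu P)"
  using H_group_P by (simp add: H_group_def Let_def)

lemma hmu_closed: "x \<in> hpoints P \<Longrightarrow> y \<in> hpoints P \<Longrightarrow> hmu P (x, y) \<in> hpoints P"
  using continuous_map_hmu by (auto simp: continuous_map_def)

lemma heta_closed: "x \<in> hpoints P \<Longrightarrow> heta P x \<in> hpoints P"
  using H_group_P by (auto simp: H_group_def Let_def continuous_map_def)

text \<open>A path component of a product space is the product of path components, and the
  continuous map \<open>hmu P\<close> sends it into a single path component. Hence the product of
  two classes can be computed on any representatives.\<close>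

lemma mult_pi0:
  assumes "x \<in> hpoints P" "y \<in> hpoints P"
  shows "pi0_class P x \<otimes>\<^bsub>pi0 P\<^esub> pi0_class P y = pi0_class P (hmu P (x, y))"
proof -
  have cong: "pi0_class P (hmu P (a, b)) = pi0_class P (hmu P (x, y))"
    if "a \<in> pi0_class P x" "b \<in> pi0_class P y" for a b
  proof -
    have "(a, b) \<in> path_component_of_set (prod_topology (hspace P) (hspace P)) (x, y)"
      using that by (simp add: pi0_class_def)
    then have "path_component_of (hspace P) (hmu P (x, y)) (hmu P (a, b))"
      using path_component_of_continuous_image[OF continuous_map_hmu] by blast
    then show ?thesis
      by (simp add: pi0_class_eqI)
  qed
  \<comment> \<open>By \<open>cong\<close> every set in the union is the desired class; these
    representatives show that the union is not empty, which gives the reverse inclusion.\<close>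
  have mem: "x \<in> pi0_class P x" "y \<in> pi0_class P y"
    using assms by (simp_all add: pi0_class_def path_component_of_refl)
  have "(\<Union>a\<in>pi0_class P x. \<Union>b\<in>pi0_class P y. pi0_class P (hmu P (a, b))) =
      pi0_class P (hmu P (x, y))"
    using mem by (intro subset_antisym UN_least equalityD1[OF cong]) blast+
  then show ?thesis
    by (simp add: pi0_def)
qed

lemma pi0_class_hmu_hbase:
  assumes "x \<in> hpoints P"
  shows "pi0_class P (hmu P (hbase P, x)) = pi0_class P x"
proof -
  have "pointed_homotopic (hspace P) (hbase P) (hspace P) (hbase P)
      (\<lambda>x. hmu P (hconst P x, x)) (\<lambda>x. x)"
    using H_group_P by (simp add: H_group_def Let_def)
  from homotopic_with_imp_path_component_of[OF this[unfolded pointed_homotopic_def] assms]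
  show ?thesis
    by (simp add: hconst_def pi0_class_eqI)
qed

lemma pi0_class_hmu_heta:
  assumes "x \<in> hpoints P"
  shows "pi0_class P (hmu P (heta P x, x)) = pi0_class P (hbase P)"
proof -
  have "pointed_homotopic (hspace P) (hbase P) (hspace P) (hbase P)
      (\<lambda>x. hmu P (heta P x, x)) (hconst P)"
    using H_group_P by (simp add: H_group_def Let_def)
  from homotopic_with_imp_path_component_of[OF this[unfolded pointed_homotopic_def] assms]
  show ?thesis
    by (simp add: hconst_def pi0_class_eqI)
qed

lemma pi0_class_hmu_assoc:
  assumes "x \<in> hpoints P" "y \<in> hpoints P" "z \<in> hpoints P"
  shows "pi0_class P (hmu P (hmu P (x, y), z)) = pi0_class P (hmu P (x, hmu P (y, z)))"
proof -
  have "pointed_homotopic (prod_topology (prod_topology (hspace P) (hspace P)) (hspace P))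
      ((hbase P, hbase P), hbase P) (hspace P) (hbase P)
      (\<lambda>((x, y), z). hmu P (hmu P (x, y), z)) (\<lambda>((x, y), z). hmu P (x, hmu P (y, z)))"
    using H_group_P by (simp add: H_group_def Let_def)
  from homotopic_with_imp_path_component_of[OF this[unfolded pointed_homotopic_def],
      of "((x, y), z)"] assms
  show ?thesis
    by (simp add: pi0_class_eqI)
qed

text \<open>The homotopies in the definition of an H-group, read pointwise, are the group axioms for
  classes. A left unit and left inverses suffice for \<open>groupI\<close>.\<close>

lemma group_pi0: "group (pi0 P)"
proof (rule groupI)
  show "\<exists>B\<in>carrier (pi0 P). B \<otimes>\<^bsub>pi0 P\<^esub> A = \<one>\<^bsub>pi0 P\<^esub>" if "A \<in> carrier (pi0 P)" for A
  proof -
    obtain x where "x \<in> hpoints P" "A = pi0_class P x"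
      using \<open>A \<in> carrier (pi0 P)\<close> by (auto simp: carrier_pi0)
    then show ?thesis
      by (intro bexI[of _ "pi0_class P (heta P x)"])
        (simp_all add: carrier_pi0 one_pi0 mult_pi0 heta_closed pi0_class_hmu_heta)
  qed
qed (auto simp: carrier_pi0 one_pi0 mult_pi0 hmu_closed hbase_closed
    pi0_class_hmu_hbase pi0_class_hmu_assoc)

lemma inv_pi0:
  assumes "x \<in> hpoints P"
  shows "inv\<^bsub>pi0 P\<^esub> (pi0_class P x) = pi0_class P (heta P x)"
  using assms
  by (intro group.inv_equality[OF group_pi0])
    (simp_all add: carrier_pi0 one_pi0 mult_pi0 heta_closed pi0_class_hmu_heta)

section \<open>The subgroup given by a sub-H-group\<close>

text \<open>The operations of the witness \<open>Q\<close> stay inside \<open>S\<close>, and because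
  the inclusion is an H-homomorphism, their values are joined by paths in \<open>P\<close> to the
  values of the operations of \<open>P\<close>. So closure under the former gives closure of the
  classes under the latter.\<close>

lemma subgroup_pi0:
  assumes "sub_H_group P S"
  shows "subgroup (pi0_class P ` S) (pi0 P)"
proof -
  obtain Q where S: "S \<subseteq> hpoints P" "hbase P \<in> S"
    and Q: "hspace Q = subtopology (hspace P) S" "H_group Q" "H_homomorphism Q P (\<lambda>x. x)"
    using assms unfolding sub_H_group_def by blast
  have pts: "hpoints Q = S"
    using S(1) Q(1) by auto
  have mu_closed: "hmu Q (x, y) \<in> S" if "x \<in> S" "y \<in> S" for x y
    using that Q(2) pts by (auto simp: H_group_def Let_def continuous_map_def)
  have eta_closed: "heta Q x \<in> S" if "x \<in> S" for x
    using that Q(2) pts by (auto simp: H_group_def Let_def continuous_map_def)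
  have mu_eq: "pi0_class P (hmu P (x, y)) = pi0_class P (hmu Q (x, y))" if "x \<in> S" "y \<in> S" for x y
  proof -
    have "homotopic_with (\<lambda>_. True) (prod_topology (hspace Q) (hspace Q)) (hspace P)
        (\<lambda>(x, y). hmu Q (x, y)) (\<lambda>(x, y). hmu P (x, y))"
      using Q(3) by (simp add: H_homomorphism_def freely_homotopic_def)
    from homotopic_with_imp_path_component_of[OF this, of "(x, y)"] that pts
    show ?thesis
      by (simp add: pi0_class_eqI)
  qed
  have eta_eq: "pi0_class P (heta P x) = pi0_class P (heta Q x)" if "x \<in> S" for x
  proof -
    have "homotopic_with (\<lambda>_. True) (hspace Q) (hspace P) (heta Q) (heta P)"
      using Q(3) by (simp add: H_homomorphism_def freely_homotopic_def)
    from homotopic_with_imp_path_component_of[OF this, of x] that pts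
    show ?thesis
      by (simp add: pi0_class_eqI)
  qed
  show ?thesis
  proof (rule group.subgroupI[OF group_pi0])
    show "pi0_class P ` S \<subseteq> carrier (pi0 P)" "pi0_class P ` S \<noteq> {}"
      using S by (auto simp: carrier_pi0)
    show "inv\<^bsub>pi0 P\<^esub> A \<in> pi0_class P ` S" if "A \<in> pi0_class P ` S" for A
      using that S(1) by (auto simp: inv_pi0 eta_eq eta_closed subset_iff)
    show "A \<otimes>\<^bsub>pi0 P\<^esub> B \<in> pi0_class P ` S"
      if "A \<in> pi0_class P ` S" "B \<in> pi0_class P ` S" for A B
      using that S(1) by (auto simp: mult_pi0 mu_eq mu_closed subset_iff)
  qed
qed

lemma normal_pi0:
  assumes "normal_sub_H_group P S"
  shows "pi0_class P ` S \<lhd> pi0 P"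
proof (rule group.normal_invI[OF group_pi0])
  have S: "sub_H_group P S" "S \<subseteq> hpoints P"
    using assms by (auto simp: normal_sub_H_group_def sub_H_group_def)
  then show "subgroup (pi0_class P ` S) (pi0 P)"
    by (simp add: subgroup_pi0)
  fix A B assume "A \<in> carrier (pi0 P)" "B \<in> pi0_class P ` S"
  then obtain g s where g: "g \<in> hpoints P" "A = pi0_class P g" and s: "s \<in> S" "B = pi0_class P s"
    by (auto simp: carrier_pi0)
  then have "path_in P (hmu P (hmu P (g, s), heta P g)) S"
    using assms by (simp add: normal_sub_H_group_def)
  then show "A \<otimes>\<^bsub>pi0 P\<^esub> B \<otimes>\<^bsub>pi0 P\<^esub> inv\<^bsub>pi0 P\<^esub> A \<in> pi0_class P ` S"
    using g s S(2)
    by (simp add: path_in_iff mult_pi0 inv_pi0 hmu_closed heta_closed subset_iff)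
qed

section \<open>Cosets in \<open>P\<close> and cosets in the group of path components\<close>

lemma mem_left_coset_iff:
  assumes "sub_H_group P S" and "g \<in> hpoints P" "x \<in> hpoints P"
  shows "x \<in> left_coset P S g \<longleftrightarrow>
    inv\<^bsub>pi0 P\<^esub> (pi0_class P g) \<otimes>\<^bsub>pi0 P\<^esub> pi0_class P x \<in> pi0_class P ` S"
  using assms
  by (simp add: left_coset_def sub_H_group_def path_in_iff inv_pi0 mult_pi0 heta_closed hmu_closed)

text \<open>A left coset is the preimage under \<open>pi0_class P\<close> of a coset of N: in a
  group, the inverse of [g] times [x] lies in N exactly when [x] lies in [g] N.\<close>

lemma left_coset_eq:
  assumes "sub_H_group P S" and "g \<in> hpoints P"
  shows "left_coset P S g =
    {x \<in> hpoints P. pi0_class P x \<in> pi0_class P g <#\<^bsub>pi0 P\<^esub> pi0_class P ` S}"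
proof -
  interpret group "pi0 P" by (rule group_pi0)
  interpret subgroup "pi0_class P ` S" "pi0 P" by (rule subgroup_pi0[OF assms(1)])
  have "x \<in> left_coset P S g \<longleftrightarrow> pi0_class P x \<in> pi0_class P g <#\<^bsub>pi0 P\<^esub> pi0_class P ` S"
    if "x \<in> hpoints P" for x
    unfolding mem_left_coset_iff[OF assms that]
  proof
    have carr: "pi0_class P g \<in> carrier (pi0 P)" "pi0_class P x \<in> carrier (pi0 P)"
      using assms(2) that by (simp_all add: carrier_pi0)
    show "pi0_class P x \<in> pi0_class P g <#\<^bsub>pi0 P\<^esub> pi0_class P ` S"
      if "inv\<^bsub>pi0 P\<^esub> pi0_class P g \<otimes>\<^bsub>pi0 P\<^esub> pi0_class P x \<in> pi0_class P ` S"
      using carr that by (rule lcos_module_rev[OF group_pi0])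
    show "inv\<^bsub>pi0 P\<^esub> pi0_class P g \<otimes>\<^bsub>pi0 P\<^esub> pi0_class P x \<in> pi0_class P ` S"
      if x: "pi0_class P x \<in> pi0_class P g <#\<^bsub>pi0 P\<^esub> pi0_class P ` S"
    proof -
      obtain B where "B \<in> pi0_class P ` S" "pi0_class P x = pi0_class P g \<otimes>\<^bsub>pi0 P\<^esub> B"
        using x unfolding l_coset_def by blast
      moreover from this have "inv\<^bsub>pi0 P\<^esub> pi0_class P g \<otimes>\<^bsub>pi0 P\<^esub> pi0_class P x = B"
        by (intro inv_solve_left'[THEN iffD2] carr mem_carrier)
      ultimately show ?thesis
        by simp
    qed
  qed
  moreover have "left_coset P S g \<subseteq> hpoints P"
    unfolding left_coset_def by (rule Collect_restrict)
  ultimately show ?thesis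
    by blast
qed

text \<open>The class of the base point is the identity of \<open>pi0 P\<close>, so its coset is N
  itself, and the preimage of N is the saturation of \<open>S\<close>.\<close>

lemma left_coset_hbase:
  assumes "sub_H_group P S"
  shows "left_coset P S (hbase P) = path_saturation P S"
proof -
  have "pi0_class P ` S \<subseteq> carrier (pi0 P)" "S \<subseteq> hpoints P"
    using assms by (auto simp: carrier_pi0 sub_H_group_def)
  then have "pi0_class P (hbase P) <#\<^bsub>pi0 P\<^esub> pi0_class P ` S = pi0_class P ` S"
    using group.lcos_mult_one[OF group_pi0] by (simp flip: one_pi0)
  then show ?thesis
    unfolding left_coset_eq[OF assms hbase_closed] path_saturation_def
    using path_in_iff[OF \<open>S \<subseteq> hpoints P\<close>] by (simp cong: conj_cong)
qed

lemma left_coset_eq_iff: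
  assumes "sub_H_group P S" and "g \<in> hpoints P" "h \<in> hpoints P"
  shows "left_coset P S g = left_coset P S h \<longleftrightarrow>
    pi0_class P g <#\<^bsub>pi0 P\<^esub> pi0_class P ` S = pi0_class P h <#\<^bsub>pi0 P\<^esub> pi0_class P ` S"
    (is "?L \<longleftrightarrow> ?C g = ?C h")
proof
  interpret group "pi0 P" by (rule group_pi0)
  have "?C k \<subseteq> pi0_class P ` hpoints P" if "k \<in> hpoints P" for k
    using l_coset_subset_G[OF subgroup.subset[OF subgroup_pi0[OF assms(1)]], of "pi0_class P k"] that
    by (simp add: carrier_pi0)
  \<comment> \<open>Every element of the coset is the class of some point, so passing to the
    preimage and then to its image loses nothing.\<close>
  then have C: "?C k = pi0_class P ` left_coset P S k" if "k \<in> hpoints P" for k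
    using that unfolding left_coset_eq[OF assms(1) that] by blast
  show "?C g = ?C h" if ?L
    using that assms by (simp add: C)
  show ?L if "?C g = ?C h"
    using that assms by (simp add: left_coset_eq)
qed

section \<open>The group structure on the set of cosets\<close>

text \<open>Well-definedness of the product. Normality of N turns left cosets into right cosets, and
  for these the coset of a product is the set product of the two cosets, so it depends only on
  them.\<close>

lemma left_coset_hmu_cong:
  assumes "normal_sub_H_group P S"
    and "g \<in> hpoints P" "g' \<in> hpoints P" "h \<in> hpoints P" "h' \<in> hpoints P"
    and "left_coset P S g = left_coset P S g'" "left_coset P S h = left_coset P S h'"
  shows "left_coset P S (hmu P (g, h)) = left_coset P S (hmu P (g', h'))"
proof -
  have S: "sub_H_group P S"
    using assms(1) by (simp add: normal_sub_H_group_def)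
  interpret normal "pi0_class P ` S" "pi0 P" by (rule normal_pi0[OF assms(1)])
  have lr: "pi0_class P k <#\<^bsub>pi0 P\<^esub> pi0_class P ` S = pi0_class P ` S #>\<^bsub>pi0 P\<^esub> pi0_class P k"
    if "k \<in> hpoints P" for k
    using coset_eq that by (simp add: carrier_pi0)
  have sum: "pi0_class P ` S #>\<^bsub>pi0 P\<^esub> pi0_class P (hmu P (a, b)) =
      (pi0_class P ` S #>\<^bsub>pi0 P\<^esub> pi0_class P a) <#>\<^bsub>pi0 P\<^esub> (pi0_class P ` S #>\<^bsub>pi0 P\<^esub> pi0_class P b)"
    if "a \<in> hpoints P" "b \<in> hpoints P" for a b
    using that rcos_sum by (simp add: carrier_pi0 mult_pi0)
  show ?thesis
    using assms(2-) by (simp add: left_coset_eq_iff[OF S] hmu_closed lr sum)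
qed

text \<open>Resolves the definite description in \<open>H_quotient\<close>: \<open>g\<close> and
  \<open>h\<close> witness existence, and \<open>left_coset_hmu_cong\<close> gives
  uniqueness.\<close>

lemma mult_H_quotient:
  assumes "normal_sub_H_group P S" and "g \<in> hpoints P" "h \<in> hpoints P"
  shows "left_coset P S g \<otimes>\<^bsub>H_quotient P S\<^esub> left_coset P S h = left_coset P S (hmu P (g, h))"
proof -
  have "(THE C. \<exists>g1\<in>hpoints P. \<exists>g2\<in>hpoints P. left_coset P S g = left_coset P S g1 \<and>
      left_coset P S h = left_coset P S g2 \<and> C = left_coset P S (hmu P (g1, g2))) =
      left_coset P S (hmu P (g, h))"
  proof (rule the_equality)
    show "C = left_coset P S (hmu P (g, h))"
      if C: "\<exists>g1\<in>hpoints P. \<exists>g2\<in>hpoints P. left_coset P S g = left_coset P S g1 \<and>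
        left_coset P S h = left_coset P S g2 \<and> C = left_coset P S (hmu P (g1, g2))" for C
    proof -
      obtain g1 g2 where "g1 \<in> hpoints P" "g2 \<in> hpoints P"
        "left_coset P S g = left_coset P S g1" "left_coset P S h = left_coset P S g2"
        "C = left_coset P S (hmu P (g1, g2))"
        using C by blast
      then show ?thesis
        using left_coset_hmu_cong[OF assms(1,2) _ assms(3), of g1 g2] by metis
    qed
  qed (use assms(2,3) in blast)
  then show ?thesis
    by (simp add: H_quotient_def)
qed

lemma carrier_H_quotient: "carrier (H_quotient P S) = left_coset P S ` hpoints P"
  by (auto simp: H_quotient_def)

lemma one_H_quotient: "\<one>\<^bsub>H_quotient P S\<^esub> = left_coset P S (hbase P)"
  by (simp add: H_quotient_def)

text \<open>A left coset depends only on the path component of its representative, so the laws that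
  hold in \<open>P\<close> up to paths become equations between cosets.\<close>

lemma group_H_quotient:
  assumes "normal_sub_H_group P S"
  shows "group (H_quotient P S)"
proof -
  have S: "sub_H_group P S"
    using assms by (simp add: normal_sub_H_group_def)
  have assoc: "left_coset P S (hmu P (hmu P (x, y), z)) = left_coset P S (hmu P (x, hmu P (y, z)))"
    and unit: "left_coset P S (hmu P (hbase P, x)) = left_coset P S x"
    and inverse: "left_coset P S (hmu P (heta P x, x)) = left_coset P S (hbase P)"
    if "x \<in> hpoints P" "y \<in> hpoints P" "z \<in> hpoints P" for x y z
    using that by (simp_all add: left_coset_eq[OF S] hmu_closed heta_closed hbase_closed
        pi0_class_hmu_assoc pi0_class_hmu_hbase pi0_class_hmu_heta)
  show ?thesis
  proof (rule groupI)
    show "\<exists>B\<in>carrier (H_quotient P S). B \<otimes>\<^bsub>H_quotient P S\<^esub> A = \<one>\<^bsub>H_quotient P S\<^esub>"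
      if "A \<in> carrier (H_quotient P S)" for A
    proof -
      obtain x where "x \<in> hpoints P" "A = left_coset P S x"
        using \<open>A \<in> carrier (H_quotient P S)\<close> by (auto simp: carrier_H_quotient)
      then show ?thesis
        by (intro bexI[of _ "left_coset P S (heta P x)"])
          (simp_all add: carrier_H_quotient one_H_quotient mult_H_quotient[OF assms] heta_closed inverse)
    qed
  qed (auto simp: carrier_H_quotient one_H_quotient mult_H_quotient[OF assms] hmu_closed hbase_closed
      assoc unit)
qed

text \<open>In a group a left inverse is the inverse, so the left inverse law for
  \<open>heta P\<close> is enough.\<close>

lemma inv_H_quotient:
  assumes "normal_sub_H_group P S" and "g \<in> hpoints P"
  shows "inv\<^bsub>H_quotient P S\<^esub> (left_coset P S g) = left_coset P S (heta P g)"
proof -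
  have S: "sub_H_group P S"
    using assms(1) by (simp add: normal_sub_H_group_def)
  have "left_coset P S (hmu P (heta P g, g)) = left_coset P S (hbase P)"
    using assms(2)
    by (simp add: left_coset_eq[OF S] hmu_closed heta_closed hbase_closed pi0_class_hmu_heta)
  then show ?thesis
    using assms(2)
    by (intro group.inv_equality[OF group_H_quotient[OF assms(1)]])
      (auto simp: mult_H_quotient[OF assms(1)] heta_closed one_H_quotient carrier_H_quotient)
qed

end

theorem theorem3p18:
  fixes P :: "'a hgroup" and P' :: "'a set"
  assumes "H_group P"
    and "normal_sub_H_group P P'"
  shows "group (H_quotient P P')
    \<and> carrier (H_quotient P P') = {left_coset P P' g | g. g \<in> hpoints P}
    \<and> (\<forall>g1\<in>hpoints P. \<forall>g2\<in>hpoints P.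
         left_coset P P' g1 \<otimes>\<^bsub>H_quotient P P'\<^esub> left_coset P P' g2
           = left_coset P P' (hmu P (g1, g2)))
    \<and> (\<forall>g\<in>hpoints P.
         inv\<^bsub>H_quotient P P'\<^esub> (left_coset P P' g) = left_coset P P' (heta P g))
    \<and> \<one>\<^bsub>H_quotient P P'\<^esub> = left_coset P P' (hbase P)
    \<and> left_coset P P' (hbase P) = path_saturation P P'"
proof -
  have "sub_H_group P P'"
    using assms(2) by (simp add: normal_sub_H_group_def)
  then show ?thesis
    using assms
    by (auto simp: carrier_H_quotient one_H_quotient group_H_quotient mult_H_quotient
        inv_H_quotient left_coset_hbase)
qed

end
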